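(* Let $q\ge 2$ be even, let $n=2k+1\ge 5$ be odd, and let $\gamma\in\{0,\ldots,q-1\}$. Then the graph $G_{n,\gamma}$ is not separable, and all its subgraphs of order $n-1$ are separable.
   Context: Fix an integer $q\ge 2$. A graph $G=(V,E)$ consists of a finite vertex set $V$ and a symmetric map $E:V^2\to\{0,1,\ldots,q-1\}$ with $E(v,v)=0$ for all $v\in V$; for distinct $v,w$, $E(v,w)$ is the weight of the edge $\{v,w\}$, weight $0$ meaning absence of an edge. The order of $G$ is $|V|$. For $W\subset V$, the subgraph $G_W$ is the graph on $W$ with the weights inherited from $G$; only such induced subgraphs are considered. A vertex is isolated if all edges at it have weight $0$. The sum of two graphs on the same vertex set has, as the weight of each edge, the sum modulo $q$ of the weights of the corresponding edges. A graph is additive if its vertices can be labelled by numbers from $\{0,\ldots,q-1\}$ so that the weight of each edge (pair of distinct vertices) equals the sum modulo $q$ of the labels of its two vertices. A switching of $G$ is the sum of $G$ with some additive graph on the same vertex set. A set $W\subset V$ is separable in $G$ (a separable set) if some switching of $G$ has no edges (of nonzero weight) between $W$ and $V\setminus W$. Every vertex set of cardinality $0,1,|V|-1$ or $|V|$ is separable; all other separable sets are called nontrivial. The graph $G$ is called separable (switching separable) if it has a nontrivial separable set of vertices. For $q$ even, $n=2k+1\ge 5$ and $\gamma\in\{0,\ldots,q-1\}$, the graph $G_{n,\gamma}$ has vertex set $\{a_0,a_1,\ldots,a_k,b_1,\ldots,b_k\}$; the vertex $a_0$ is isolated; for $l,m\in\{1,\ldots,k\}$ the edge $\{a_l,b_m\}$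 has weight $\gamma$ if $l<m$ and weight $\gamma+q/2 \pmod q$ if $l\ge m$; for distinct $l,m\in\{1,\ldots,k\}$ the edges $\{a_l,a_m\}$ and $\{b_l,b_m\}$ have weight $\gamma$. *)

theory Defs
  imports Main
begin

text \<open>
  Edge weights are natural numbers below \<open>q\<close>. The weight function is total on the vertex type;
  its values outside the vertex set carry no meaning and do not affect separability.
\<close>

record 'v wgraph =
  verts :: "'v set"
  weight :: "'v \<Rightarrow> 'v \<Rightarrow> nat"

definition is_wgraph :: "nat \<Rightarrow> 'v wgraph \<Rightarrow> bool" where
  "is_wgraph q G \<longleftrightarrow>
     finite (verts G) \<and>
     (\<forall>v\<in>verts G. \<forall>w\<in>verts G. weight G v w < q) \<and>
     (\<forall>v\<in>verts G. \<forall>w\<in>verts G. weight G v w = weight G w v) \<and>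
     (\<forall>v\<in>verts G. weight G v v = 0)"

definition induced_subgraph :: "'v wgraph \<Rightarrow> 'v set \<Rightarrow> 'v wgraph" where
  "induced_subgraph G W = \<lparr>verts = W, weight = weight G\<rparr>"

definition graph_sum :: "nat \<Rightarrow> 'v wgraph \<Rightarrow> 'v wgraph \<Rightarrow> 'v wgraph" where
  "graph_sum q G H =
     \<lparr>verts = verts G, weight = (\<lambda>v w. (weight G v w + weight H v w) mod q)\<rparr>"

definition additive_graph :: "nat \<Rightarrow> 'v wgraph \<Rightarrow> bool" where
  "additive_graph q G \<longleftrightarrow>
     is_wgraph q G \<and>
     (\<exists>f. (\<forall>v\<in>verts G. f v < q) \<and>
          (\<forall>v\<in>verts G. \<forall>w\<in>verts G. v \<noteq> w \<longrightarrow> weight G v w = (f v + f w) mod q))"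

definition is_switching :: "nat \<Rightarrow> 'v wgraph \<Rightarrow> 'v wgraph \<Rightarrow> bool" where
  "is_switching q G S \<longleftrightarrow>
     (\<exists>A. additive_graph q A \<and> verts A = verts G \<and> S = graph_sum q G A)"

definition separable_set :: "nat \<Rightarrow> 'v wgraph \<Rightarrow> 'v set \<Rightarrow> bool" where
  "separable_set q G W \<longleftrightarrow>
     W \<subseteq> verts G \<and>
     (\<exists>S. is_switching q G S \<and> (\<forall>v\<in>W. \<forall>w\<in>verts G - W. weight S v w = 0))"

definition nontrivial_separable_set :: "nat \<Rightarrow> 'v wgraph \<Rightarrow> 'v set \<Rightarrow> bool" where
  "nontrivial_separable_set q G W \<longleftrightarrow>
     separable_set q G W \<and>
     card W \<noteq> 0 \<and> card W \<noteq> 1 \<and> card W + 1 \<noteq> card (verts G) \<and> card W \<noteq> card (verts G)"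

definition separable :: "nat \<Rightarrow> 'v wgraph \<Rightarrow> bool" where
  "separable q G \<longleftrightarrow> (\<exists>W. nontrivial_separable_set q G W)"

text \<open>\<open>A l\<close> and \<open>B m\<close> stand for the vertices \<open>a\<^sub>l\<close> and \<open>b\<^sub>m\<close>.\<close>

datatype vertex = A nat | B nat

fun Gn_weight :: "nat \<Rightarrow> nat \<Rightarrow> vertex \<Rightarrow> vertex \<Rightarrow> nat" where
  "Gn_weight q \<gamma> (A l) (A m) = (if l = 0 \<or> m = 0 \<or> l = m then 0 else \<gamma>)"
| "Gn_weight q \<gamma> (B l) (B m) = (if l = m then 0 else \<gamma>)"
| "Gn_weight q \<gamma> (A l) (B m) =
     (if l = 0 then 0 else if l < m then \<gamma> else (\<gamma> + q div 2) mod q)"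
| "Gn_weight q \<gamma> (B m) (A l) =
     (if l = 0 then 0 else if l < m then \<gamma> else (\<gamma> + q div 2) mod q)"

text \<open>Meant for odd \<open>n\<close>: writing \<open>n = 2 * k + 1\<close>, we have \<open>n div 2 = k\<close>.\<close>

definition Gn :: "nat \<Rightarrow> nat \<Rightarrow> nat \<Rightarrow> vertex wgraph" where
  "Gn q n \<gamma> = \<lparr>verts = A ` {0..n div 2} \<union> B ` {1..n div 2}, weight = Gn_weight q \<gamma>\<rparr>"

lemma is_wgraph_Gn:
  assumes "\<gamma> < q"
  shows "is_wgraph q (Gn q n \<gamma>)"
  using assms by (auto simp: is_wgraph_def Gn_def)

lemma card_verts_Gn:
  assumes "odd n"
  shows "card (verts (Gn q n \<gamma>)) = n"
proof -
  have "card (A ` {0..n div 2} \<union> B ` {1..n div 2})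
      = card (A ` {0..n div 2}) + card (B ` {1..n div 2})"
    by (rule card_Un_disjoint) auto
  also have "\<dots> = Suc (n div 2) + n div 2"
    by (simp add: card_image inj_on_def)
  also have "\<dots> = n"
    using assms by presburger
  finally show ?thesis
    by (simp add: Gn_def)
qed

end

theory Submission
  imports Defs "HOL-Number_Theory.Cong"
begin

text \<open>
  Let \<open>W\<close> be separable. Separability passes to complements, so the isolated vertex \<open>a\<^sub>0\<close> may be
  assumed to lie outside \<open>W\<close>. A switching that removes the edges from \<open>W\<close> to \<open>a\<^sub>0\<close> must have the
  same label on all of \<open>W\<close>; if it also removes the edges from \<open>W\<close> to the other outside vertices,
  then each of these sees all of \<open>W\<close> with one and the same weight
  (\<open>separable_set_constant_rows\<close>). Hence \<open>W\<close> is a module of the half graph in which \<open>a\<^sub>l\<close> and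
  \<open>b\<^sub>m\<close> are adjacent iff \<open>l \<ge> m\<close>. Half graphs are prime (\<open>half_graph_prime\<close>): a module with at
  least two vertices is everything. So \<open>W\<close> is trivial.

  After the deletion of any vertex, some pair of vertices \<open>x\<close>, \<open>y\<close> becomes separable, because its
  rows of weights to the remaining vertices differ by a constant (\<open>separable_by_pair\<close>):

  \<^item> without \<open>a\<^sub>i\<close>, \<open>1 \<le> i < k\<close>, the vertices \<open>b\<^sub>i\<close> and \<open>b\<^bsub>i+1\<^esub>\<close> are twins, and symmetrically
    \<open>a\<^bsub>i-1\<^esub>\<close> and \<open>a\<^sub>i\<close> without \<open>b\<^sub>i\<close>, \<open>1 < i\<close>;
  \<^item> without \<open>a\<^sub>k\<close>, all edges at \<open>b\<^sub>k\<close> other than the one to \<open>a\<^sub>0\<close> have weight \<open>\<gamma>\<close>, so its row differs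
    by \<open>\<gamma>\<close> from that of \<open>a\<^sub>0\<close>; similarly for \<open>a\<^sub>1\<close> without \<open>b\<^sub>1\<close>;
  \<^item> without \<open>a\<^sub>0\<close>, the vertex \<open>a\<^sub>k\<close> is adjacent in the half graph to all \<open>b\<^sub>j\<close> and no \<open>a\<^sub>j\<close>, the vertex
    \<open>b\<^sub>1\<close> to all \<open>a\<^sub>j\<close> and no \<open>b\<^sub>j\<close>. Their rows differ by \<open>q/2\<close> everywhere, since \<open>q/2\<close> and \<open>-q/2\<close>
    agree modulo \<open>q\<close>.
\<close>

section \<open>Separable sets in terms of labellings\<close>

lemma separable_set_iff_labelling:
  assumes G: "is_wgraph q G" and "q > 0"
  shows "separable_set q G W \<longleftrightarrow>
    W \<subseteq> verts G \<and> (\<exists>f. \<forall>v\<in>W. \<forall>u\<in>verts G - W. (weight G v u + (f v + f u)) mod q = 0)"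
    (is "?L \<longleftrightarrow> ?R")
proof
  assume ?L
  then obtain A f where W: "W \<subseteq> verts G" and "verts A = verts G"
    and f: "\<forall>v\<in>verts A. \<forall>w\<in>verts A. v \<noteq> w \<longrightarrow> weight A v w = (f v + f w) mod q"
    and z: "\<forall>v\<in>W. \<forall>w\<in>verts G - W. weight (graph_sum q G A) v w = 0"
    unfolding separable_set_def is_switching_def additive_graph_def by blast
  have "(weight G v u + (f v + f u)) mod q = 0" if "v \<in> W" "u \<in> verts G - W" for v u
  proof -
    have "weight A v u = (f v + f u) mod q"
      using f that W \<open>verts A = verts G\<close> by auto
    moreover have "(weight G v u + weight A v u) mod q = 0"
      using z that by (simp add: graph_sum_def)
    ultimately show ?thesis
      by (simp add: mod_add_right_eq)
  qed
  then show ?R using W by blast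
next
  assume ?R
  then obtain f where W: "W \<subseteq> verts G"
    and f: "\<And>v u. v \<in> W \<Longrightarrow> u \<in> verts G - W \<Longrightarrow> (weight G v u + (f v + f u)) mod q = 0"
    by blast
  define H where
    "H = \<lparr>verts = verts G, weight = (\<lambda>v w. if v = w then 0 else (f v + f w) mod q)\<rparr>"
  have "additive_graph q H"
    unfolding additive_graph_def
  proof (intro conjI exI[of _ "\<lambda>v. f v mod q"])
    show "is_wgraph q H"
      using G \<open>q > 0\<close> by (auto simp: is_wgraph_def H_def add.commute)
  qed (use \<open>q > 0\<close> in \<open>auto simp: H_def mod_simps\<close>)
  then have "is_switching q G (graph_sum q G H)"
    unfolding is_switching_def by (auto simp: H_def)
  moreover have "weight (graph_sum q G H) v u = 0" if "v \<in> W" "u \<in> verts G - W" for v u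
    using f[OF that] that by (auto simp: graph_sum_def H_def mod_simps)
  ultimately show ?L
    unfolding separable_set_def using W by blast
qed

lemma separable_set_complement:
  assumes G: "is_wgraph q G" and "q > 0" and W: "separable_set q G W"
  shows "separable_set q G (verts G - W)"
proof -
  obtain f where WV: "W \<subseteq> verts G"
    and f: "\<forall>v\<in>W. \<forall>u\<in>verts G - W. (weight G v u + (f v + f u)) mod q = 0"
    using iffD1[OF separable_set_iff_labelling[OF G \<open>q > 0\<close>] W] by blast
  have "(weight G v u + (f v + f u)) mod q = 0"
    if "v \<in> verts G - W" "u \<in> verts G - (verts G - W)" for v u
  proof -
    have "weight G v u = weight G u v"
      using G that unfolding is_wgraph_def by blast
    moreover have "(weight G u v + (f u + f v)) mod q = 0"
      using f that by blast
    ultimately show ?thesis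
      by (metis add.commute)
  qed
  then show ?thesis
    unfolding separable_set_iff_labelling[OF G \<open>q > 0\<close>]
    by (intro conjI exI[of _ f] ballI) auto
qed

text \<open>
  The weight-zero edges to \<open>z\<close> force the labels on \<open>W\<close> to be equal, so the switching adds the same
  amount to all edges from a given outside vertex to \<open>W\<close>.
\<close>

lemma separable_set_constant_rows:
  assumes G: "is_wgraph q G" and "q > 0" and W: "separable_set q G W"
    and z: "z \<in> verts G - W" "\<And>v. v \<in> W \<Longrightarrow> weight G v z = 0"
    and v: "v \<in> W" "v' \<in> W" and u: "u \<in> verts G - W"
  shows "weight G v u = weight G v' u"
proof -
  obtain f where WV: "W \<subseteq> verts G"
    and f: "\<forall>v\<in>W. \<forall>u\<in>verts G - W. (weight G v u + (f v + f u)) mod q = 0"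
    using iffD1[OF separable_set_iff_labelling[OF G \<open>q > 0\<close>] W] by blast
  have "(weight G x z + (f x + f z)) mod q = 0" if "x \<in> W" for x
    using f z(1) that by blast
  then have "[f v + f z = f v' + f z] (mod q)"
    using v z(2) by (simp add: cong_def)
  then have "[f v + f u = f v' + f u] (mod q)"
    by (simp add: cong_add_rcancel_nat)
  moreover have "[weight G v u + (f v + f u) = weight G v' u + (f v' + f u)] (mod q)"
  proof -
    have "(weight G x u + (f x + f u)) mod q = 0" if "x \<in> W" for x
      using f u that by blast
    then show ?thesis
      using v by (simp add: cong_def)
  qed
  ultimately have "[weight G v u + (f v' + f u) = weight G v' u + (f v' + f u)] (mod q)"
    using cong_trans[OF cong_add[OF cong_refl cong_sym]] by blast
  then have "[weight G v u = weight G v' u] (mod q)"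
    by (simp only: cong_add_rcancel_nat)
  moreover have "weight G v u < q" "weight G v' u < q"
    using G v u WV by (auto simp: is_wgraph_def)
  ultimately show ?thesis
    by (simp add: cong_def)
qed

text \<open>
  Giving \<open>x\<close> the label \<open>c\<close> and \<open>y\<close> the label \<open>0\<close> makes the two rows equal; each other vertex \<open>u\<close>
  then cancels its two edges to the pair by the label \<open>-weight G y u\<close>.
\<close>

lemma separable_by_pair:
  assumes G: "is_wgraph q G" and "q > 0" and "card (verts G) \<ge> 4"
    and xy: "x \<in> verts G" "y \<in> verts G" "x \<noteq> y"
    and rows: "\<And>u. u \<in> verts G - {x, y} \<Longrightarrow> (weight G x u + c) mod q = weight G y u"
  shows "separable q G"
proof -
  define f where "f = (\<lambda>u. if u = x then c else if u = y then 0 else q - weight G y u)"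
  have "(weight G v u + (f v + f u)) mod q = 0" if "v \<in> {x, y}" "u \<in> verts G - {x, y}" for v u
  proof -
    have "weight G y u < q"
      using G xy that by (auto simp: is_wgraph_def)
    moreover have "(weight G x u + (c + (q - weight G y u))) mod q
        = ((weight G x u + c) mod q + (q - weight G y u)) mod q"
      by (simp add: mod_add_left_eq add.assoc)
    ultimately show ?thesis
      using that rows[OF that(2)] by (auto simp: f_def)
  qed
  then have "separable_set q G {x, y}"
    unfolding separable_set_iff_labelling[OF G \<open>q > 0\<close>]
    using xy by (intro conjI exI[of _ f] ballI) auto
  moreover have "card {x, y} = 2"
    using xy by simp
  ultimately have "nontrivial_separable_set q G {x, y}"
    using assms(3) by (simp add: nontrivial_separable_set_def)
  then show ?thesis
    unfolding separable_def by blast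
qed

section \<open>The half graph is prime\<close>

text \<open>
  Read weight \<open>\<gamma>\<close> as non-adjacency and weight \<open>\<gamma> + q/2\<close> as adjacency.
  The vertex \<open>a\<^sub>k\<close> is adjacent to every \<open>b\<^sub>m\<close> and to no \<open>a\<^sub>l\<close>, and \<open>b\<^sub>1\<close> vice versa. So a module
  containing vertices of both kinds contains \<open>a\<^sub>k\<close>, hence every \<open>b\<^sub>j\<close>, in particular \<open>b\<^sub>1\<close>, and hence
  every \<open>a\<^sub>j\<close>. Two vertices of the same kind are always distinguished by a vertex of the other kind,
  which must then belong to the module, too.
\<close>

lemma half_graph_prime:
  assumes T: "T \<subseteq> A ` {1..k} \<union> B ` {1..k}"
    and xy: "x \<in> T" "y \<in> T" "x \<noteq> y"
    and module: "\<And>v v' u. v \<in> T \<Longrightarrow> v' \<in> T \<Longrightarrow> u \<in> A ` {1..k} \<union> B ` {1..k} - T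
      \<Longrightarrow> Gn_weight q \<gamma> v u = Gn_weight q \<gamma> v' u"
    and neq: "(\<gamma> + q div 2) mod q \<noteq> \<gamma>"
  shows "T = A ` {1..k} \<union> B ` {1..k}"
proof -
  note neq' = neq neq[symmetric]
  have mem: "u \<in> T" if "v \<in> T" "v' \<in> T" "u \<in> A ` {1..k} \<union> B ` {1..k}"
    "Gn_weight q \<gamma> v u \<noteq> Gn_weight q \<gamma> v' u" for v v' u
    using module that by blast
  have rangeA: "1 \<le> l \<and> l \<le> k" if "A l \<in> T" for l using T that by auto
  have rangeB: "1 \<le> l \<and> l \<le> k" if "B l \<in> T" for l using T that by auto
  have mixed: "T = A ` {1..k} \<union> B ` {1..k}" if a: "A l \<in> T" and b: "B m \<in> T" for l m
  proof -
    note lm = rangeA[OF a] rangeB[OF b]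
    have ak: "A k \<in> T"
    proof (cases "l = k")
      case False
      then show ?thesis
        using lm neq' by (intro mem[OF a b]) auto
    qed (use a in simp)
    have bs: "B j \<in> T" if "1 \<le> j" "j \<le> k" for j
    proof (cases "j = m")
      case False
      then show ?thesis
        using lm neq' that by (intro mem[OF ak b]) auto
    qed (use b in simp)
    have b1: "B 1 \<in> T" using bs lm by simp
    have as: "A j \<in> T" if "1 \<le> j" "j \<le> k" for j
    proof (cases "j = k")
      case False
      then show ?thesis
        using neq' that by (intro mem[OF ak b1]) auto
    qed (use ak in simp)
    show ?thesis using T as bs by auto
  qed
  have twoA: "T = A ` {1..k} \<union> B ` {1..k}" if l: "A l \<in> T" and m: "A m \<in> T" and "l < m" for l m
  proof -
    have "B m \<in> T"
      using \<open>l < m\<close> rangeA[OF l] rangeA[OF m] neq' by (intro mem[OF l m]) auto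
    then show ?thesis using mixed l by blast
  qed
  have twoB: "T = A ` {1..k} \<union> B ` {1..k}" if l: "B l \<in> T" and m: "B m \<in> T" and "l < m" for l m
  proof -
    have "A l \<in> T"
      using \<open>l < m\<close> rangeB[OF l] rangeB[OF m] neq' by (intro mem[OF l m]) auto
    then show ?thesis using mixed m by blast
  qed
  show ?thesis
  proof (cases x)
    case [simp]: (A l)
    show ?thesis
    proof (cases y)
      case (A m)
      then show ?thesis using xy twoA[of l m] twoA[of m l] by (cases l m rule: linorder_cases) auto
    next
      case (B m)
      then show ?thesis using xy mixed by simp
    qed
  next
    case [simp]: (B l)
    show ?thesis
    proof (cases y)
      case (A m)
      then show ?thesis using xy mixed by simp
    next
      case (B m)
      then show ?thesis using xy twoB[of l m] twoB[of m l] by (cases l m rule: linorder_cases) auto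
    qed
  qed
qed

section \<open>The critical graphs\<close>

lemma verts_Gn: "verts (Gn q n \<gamma>) = insert (A 0) (A ` {1..n div 2} \<union> B ` {1..n div 2})"
proof -
  have "{0..n div 2} = insert 0 {1..n div 2}" by auto
  then show ?thesis by (simp add: Gn_def)
qed

lemma half_shift_neq:
  fixes \<gamma> :: nat
  assumes "q \<ge> 2" "\<gamma> < q"
  shows "(\<gamma> + q div 2) mod q \<noteq> \<gamma>"
proof
  assume "(\<gamma> + q div 2) mod q = \<gamma>"
  then have "[\<gamma> + q div 2 = \<gamma> + 0] (mod q)"
    using assms by (simp add: cong_def)
  then have "[q div 2 = 0] (mod q)"
    by (simp only: cong_add_lcancel_nat)
  then show False
    using assms by (simp add: cong_def)
qed

lemma Gn_not_separable:
  assumes "q \<ge> 2" and "odd n" and "\<gamma> < q"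
  shows "\<not> separable q (Gn q n \<gamma>)"
proof
  let ?G = "Gn q n \<gamma>"
  have q: "q > 0" using assms by simp
  note G = is_wgraph_Gn[OF \<open>\<gamma> < q\<close>, of n]
  note crd = card_verts_Gn[OF \<open>odd n\<close>, of q \<gamma>]
  have fin: "finite (verts ?G)" using G by (simp add: is_wgraph_def)
  have avoiding_a0: False if W: "nontrivial_separable_set q ?G W" and "A 0 \<notin> W" for W
  proof -
    have sep: "separable_set q ?G W" and c: "card W \<noteq> 0" "card W \<noteq> 1" "card W + 1 \<noteq> n"
      using W crd by (auto simp: nontrivial_separable_set_def)
    have "W \<subseteq> verts ?G" using sep by (simp add: separable_set_def)
    then have sub: "W \<subseteq> A ` {1..n div 2} \<union> B ` {1..n div 2}"
      using \<open>A 0 \<notin> W\<close> by (auto simp: verts_Gn)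
    obtain x y where xy: "x \<in> W" "y \<in> W" "x \<noteq> y"
    proof -
      obtain x where "x \<in> W" using c by fastforce
      moreover have "W \<noteq> {x}" using c by auto
      ultimately show ?thesis using that by blast
    qed
    have zero: "weight ?G v (A 0) = 0" for v
      by (cases v) (auto simp: Gn_def)
    have "W = A ` {1..n div 2} \<union> B ` {1..n div 2}"
    proof (rule half_graph_prime[OF sub xy])
      show "(\<gamma> + q div 2) mod q \<noteq> \<gamma>"
        using assms by (intro half_shift_neq)
    next
      fix v v' u
      assume "v \<in> W" "v' \<in> W" "u \<in> A ` {1..n div 2} \<union> B ` {1..n div 2} - W"
      then have "weight ?G v u = weight ?G v' u"
        using \<open>A 0 \<notin> W\<close> by (intro separable_set_constant_rows[OF G q sep _ zero]) (auto simp: verts_Gn)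
      then show "Gn_weight q \<gamma> v u = Gn_weight q \<gamma> v' u"
        by (simp add: Gn_def)
    qed
    then have "verts ?G = insert (A 0) W"
      by (simp add: verts_Gn)
    then have "n = card W + 1"
      using crd fin \<open>A 0 \<notin> W\<close> by simp
    then show False using c by simp
  qed
  assume "separable q ?G"
  then obtain W where W: "nontrivial_separable_set q ?G W"
    unfolding separable_def by blast
  show False
  proof (cases "A 0 \<in> W")
    case True
    have sub: "W \<subseteq> verts ?G"
      using W by (simp add: nontrivial_separable_set_def separable_set_def)
    then have "card (verts ?G - W) = card (verts ?G) - card W" "card W \<le> card (verts ?G)"
      using fin by (auto simp: card_Diff_subset finite_subset card_mono)
    then have "nontrivial_separable_set q ?G (verts ?G - W)"
      using W separable_set_complement[OF G q, of W]
      unfolding nontrivial_separable_set_def by auto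
    then show False using avoiding_a0 True by blast
  qed (use avoiding_a0 W in blast)
qed

lemma Gn_minus_vertex_separable:
  assumes "q \<ge> 2" and "even q" and "n \<ge> 5" and "odd n" and "\<gamma> < q"
    and x: "x \<in> verts (Gn q n \<gamma>)"
  shows "separable q (induced_subgraph (Gn q n \<gamma>) (verts (Gn q n \<gamma>) - {x}))"
proof -
  let ?G = "Gn q n \<gamma>"
  let ?H = "induced_subgraph ?G (verts ?G - {x})"
  define k where "k = n div 2"
  have k: "k \<ge> 2" using assms by (simp add: k_def)
  have q: "q > 0" using assms by simp
  have vH: "verts ?H = insert (A 0) (A ` {1..k} \<union> B ` {1..k}) - {x}"
    by (simp add: induced_subgraph_def verts_Gn k_def)
  have wH: "weight ?H = Gn_weight q \<gamma>"
    by (simp add: induced_subgraph_def Gn_def)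
  have H: "is_wgraph q ?H"
    using is_wgraph_Gn[OF \<open>\<gamma> < q\<close>, of n] by (auto simp: is_wgraph_def induced_subgraph_def)
  have "card (verts ?H) = n - 1"
    using card_verts_Gn[OF \<open>odd n\<close>, of q \<gamma>] x by (simp add: induced_subgraph_def)
  then have "card (verts ?H) \<ge> 4" using assms by simp
  note pair = separable_by_pair[OF H q this, unfolded vH wH]
  have twice: "(\<gamma> + q div 2 + q div 2) mod q = \<gamma>"
  proof -
    have "q div 2 + q div 2 = q"
      using \<open>even q\<close> by presburger
    then show ?thesis using \<open>\<gamma> < q\<close> by (simp add: add.assoc)
  qed
  from x consider "x = A 0" | "x = A k" | "x = B 1"
    | i where "x = A i" "1 \<le> i" "i < k" | i where "x = B i" "1 < i" "i \<le> k"
    by (force simp: verts_Gn k_def)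
  then show ?thesis
  proof cases
    case 1
    show ?thesis
      by (rule pair[of "A k" "B 1" "q div 2"])
        (use 1 k twice \<open>\<gamma> < q\<close> in \<open>auto simp: mod_simps split: if_splits\<close>)
  next
    case 2
    show ?thesis
      by (rule pair[of "A 0" "B k" \<gamma>]) (use 2 k \<open>\<gamma> < q\<close> in \<open>auto split: if_splits\<close>)
  next
    case 3
    show ?thesis
      by (rule pair[of "A 0" "A 1" \<gamma>]) (use 3 k \<open>\<gamma> < q\<close> in \<open>auto split: if_splits\<close>)
  next
    case 4
    show ?thesis
      by (rule pair[of "B i" "B (Suc i)" 0]) (use 4 k \<open>\<gamma> < q\<close> in \<open>auto split: if_splits\<close>)
  next
    case 5
    have "A (i - 1) \<in> A ` {1..k}"
      using 5 by (intro imageI) auto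
    then show ?thesis
      by (intro pair[of "A (i - 1)" "A i" 0]) (use 5 k \<open>\<gamma> < q\<close> in \<open>auto split: if_splits\<close>)
  qed
qed

theorem mainTheorem2:
  fixes q n \<gamma> :: nat
  assumes "q \<ge> 2" and "even q" and "n \<ge> 5" and "odd n" and "\<gamma> < q"
  shows "\<not> separable q (Gn q n \<gamma>) \<and>
    (\<forall>W \<subseteq> verts (Gn q n \<gamma>). card W = n - 1 \<longrightarrow>
       separable q (induced_subgraph (Gn q n \<gamma>) W))"
proof (intro conjI allI impI)
  show "\<not> separable q (Gn q n \<gamma>)"
    using Gn_not_separable assms by blast
next
  fix W
  let ?V = "verts (Gn q n \<gamma>)"
  assume W: "W \<subseteq> ?V" "card W = n - 1"
  have "finite ?V" by (simp add: Gn_def)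
  then have "card (?V - W) = 1"
    using W assms card_verts_Gn[OF \<open>odd n\<close>, of q \<gamma>] by (simp add: card_Diff_subset finite_subset)
  then obtain x where "?V - W = {x}"
    by (auto simp: card_1_singleton_iff)
  then have "x \<in> ?V" "W = ?V - {x}"
    using W by auto
  then show "separable q (induced_subgraph (Gn q n \<gamma>) W)"
    using Gn_minus_vertex_separable[OF assms] by simp
qed

end
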